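(* Let $f=S(e^{z/q})$ with $q$ a positive integer and $S\in\mathbb C(u)$ nonconstant. Then for every $a\in\mathbb P^1$ the set $E_a(f)$ is finite. More precisely, $$E_a(f)=\{\alpha^q:\alpha\in\mathbb C^*,\ S(\alpha)=a\},$$ and $$f^{-1}(a)=\bigcup_{\substack{\alpha\in\mathbb C^*\\ S(\alpha)=a}}\bigl(q\log\alpha+2\pi i q\mathbb Z\bigr),$$ where any logarithm of $\alpha$ may be used in each coset. The multiplicity of the $a$-points of $f$ is constant on each coset and equals the local multiplicity of $S$ at $\alpha$.
   Context: $\mathbb P^1=\mathbb C\cup\{\infty\}$. For a nonconstant meromorphic function $f$ on $\mathbb C$ and $a\in\mathbb P^1$, the exponential fibre set is $E_a(f)=\{e^z: z\in\mathbb C,\ f(z)=a\}$; for $a=\infty$, the preimage $f^{-1}(\infty)$ means the set of poles of $f$. *)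

theory Defs
  imports
    "HOL-Complex_Analysis.Complex_Analysis"
    "HOL-Computational_Algebra.Field_as_Ring"
    "HOL-Computational_Algebra.Polynomial_Factorial"
begin

datatype sphere = Finite complex | Infinity

text \<open>
  \<^term>\<open>quot_of_fract\<close> is the representation in lowest terms, so that numerator and denominator
  have no common zero. Division by zero gives the value 0 at the poles, as
  \<^const>\<open>nicely_meromorphic_on\<close> requires.
\<close>

definition rat_fun :: "complex poly fract \<Rightarrow> complex \<Rightarrow> complex" where
  "rat_fun S u = poly (fst (quot_of_fract S)) u / poly (snd (quot_of_fract S)) u"

definition nonconstant_rat :: "complex poly fract \<Rightarrow> bool" where
  "nonconstant_rat S \<longleftrightarrow> (\<nexists>c. S = to_fract [:c:])"

text \<open>
  The remaining definitions are meant for functions that are \<^const>\<open>nicely_meromorphic_on\<close>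
  the plane, whose value at every point that is not a pole is the limit there.
\<close>

definition sphere_value :: "(complex \<Rightarrow> complex) \<Rightarrow> complex \<Rightarrow> sphere" where
  "sphere_value f z = (if is_pole f z then Infinity else Finite (f z))"

definition fibre :: "(complex \<Rightarrow> complex) \<Rightarrow> sphere \<Rightarrow> complex set" where
  "fibre f a = {z. sphere_value f z = a}"

definition exp_fibre :: "(complex \<Rightarrow> complex) \<Rightarrow> sphere \<Rightarrow> complex set" where
  "exp_fibre f a = exp ` fibre f a"

text \<open>
  The multiplicity with which \<open>f\<close> takes its value at \<open>z\<close>: the order of the zero of
  \<open>f - f z\<close>, or the order of the pole.
\<close>

definition local_mult :: "(complex \<Rightarrow> complex) \<Rightarrow> complex \<Rightarrow> int" where
  "local_mult f z = (if is_pole f z then - zorder f z else zorder (\<lambda>w. f w - f z) z)"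

definition log_coset :: "nat \<Rightarrow> complex \<Rightarrow> complex set" where
  "log_coset q l = {of_nat q * l + 2 * of_real pi * \<i> * of_nat q * of_int k | k :: int. True}"

lemma is_pole_rat_comp_iff:
  assumes g: "g analytic_on UNIV" and nc: "\<And>z. deriv g z \<noteq> 0"
  shows "is_pole (\<lambda>z. rat_fun S (g z)) z \<longleftrightarrow> poly (snd (quot_of_fract S)) (g z) = 0"
proof -
  define p r where "p = fst (quot_of_fract S)" and "r = snd (quot_of_fract S)"
  have r0: "r \<noteq> 0" by (simp add: r_def)
  have cop: "coprime p r"
    unfolding p_def r_def by (rule coprime_quot_of_fract)
  have eq: "(\<lambda>z. rat_fun S (g z)) = (\<lambda>z. poly p (g z) / poly r (g z))"
    by (simp add: rat_fun_def p_def r_def fun_eq_iff)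
  have gz: "g analytic_on {z}" using g analytic_on_subset by blast
  have gc: "isCont g z" using gz analytic_at_imp_isCont by blast
  show ?thesis
  proof (cases "poly r (g z) = 0")
    case False
    have "isCont (\<lambda>z. poly p (g z) / poly r (g z)) z"
      using gc False by (intro continuous_intros) auto
    then have "\<not> is_pole (\<lambda>z. poly p (g z) / poly r (g z)) z"
      unfolding isCont_def is_pole_def
      using not_tendsto_and_filterlim_at_infinity[of "at z"] by (metis at_neq_bot)
    then show ?thesis using False by (simp add: eq r_def)
  next
    case True
    have pz: "poly p (g z) \<noteq> 0"
    proof
      assume "poly p (g z) = 0"
      then have "[:-g z, 1:] dvd p" "[:-g z, 1:] dvd r" using True by (auto simp: poly_eq_0_iff_dvd)
      then have "is_unit [:-g z, 1:]" using cop by (meson coprime_common_divisor)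
      then show False by (simp add: is_unit_poly_iff)
    qed
    have ne: "\<forall>\<^sub>F w in at z. g w \<noteq> c" for c
    proof (cases "c = g z")
      case False
      then show ?thesis
        using gc tendsto_imp_eventually_ne[of g "g z" "at z" c] by (simp add: isCont_def)
    next
      case True
      have "(g has_field_derivative deriv g z) (at z)"
        using gz analytic_on_imp_differentiable_at DERIV_deriv_iff_field_differentiable by blast
      then have "((\<lambda>w. (g w - g z) / (w - z)) \<longlongrightarrow> deriv g z) (at z)"
        by (simp add: has_field_derivative_iff)
      then have "\<forall>\<^sub>F w in at z. (g w - g z) / (w - z) \<noteq> 0"
        by (rule tendsto_imp_eventually_ne) (rule nc)
      then show ?thesis by (rule eventually_mono) (auto simp: True)
    qed
    have "finite {u. poly r u = 0}" using r0 poly_roots_finite by blast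
    then have "\<forall>\<^sub>F w in at z. \<forall>c\<in>{u. poly r u = 0}. g w \<noteq> c"
      using ne by (intro eventually_ball_finite) auto
    then have nz: "\<forall>\<^sub>F w in at z. poly r (g w) \<noteq> 0"
      by (rule eventually_mono) auto
    have "filterlim (\<lambda>w. poly r (g w)) (at 0) (at z)"
      unfolding filterlim_at
    proof
      show "\<forall>\<^sub>F w in at z. poly r (g w) \<in> UNIV \<and> poly r (g w) \<noteq> 0" using nz by simp
      have "isCont (\<lambda>w. poly r (g w)) z" using gc by (intro continuous_intros)
      then show "((\<lambda>w. poly r (g w)) \<longlongrightarrow> 0) (at z)" using True by (simp add: isCont_def)
    qed
    moreover have "isCont (\<lambda>w. poly p (g w)) z" using gc by (intro continuous_intros)
    ultimately have "is_pole (\<lambda>w. poly p (g w) / poly r (g w)) z"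
      unfolding is_pole_def using pz
      by (intro filterlim_divide_at_infinity) (auto simp: isCont_def)
    then show ?thesis using True by (simp add: eq r_def)
  qed
qed

lemma rat_comp_nicely_meromorphic:
  assumes g: "g analytic_on UNIV" and nc: "\<And>z. deriv g z \<noteq> 0"
  shows "(\<lambda>z. rat_fun S (g z)) nicely_meromorphic_on UNIV"
  unfolding nicely_meromorphic_on_def
proof (intro conjI ballI)
  have pg: "(\<lambda>z. poly p (g z)) analytic_on UNIV" for p :: "complex poly"
  proof -
    have "poly p analytic_on UNIV"
      by (simp add: analytic_on_open) (auto intro!: holomorphic_intros)
    then show ?thesis using analytic_on_compose_gen[OF g, of "poly p" UNIV] by (simp add: o_def)
  qed
  show "(\<lambda>z. rat_fun S (g z)) meromorphic_on UNIV"
    unfolding rat_fun_def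
    by (intro meromorphic_on_divide analytic_on_imp_meromorphic_on pg)
  fix z
  have gc: "isCont g z"
    using g analytic_at_imp_isCont analytic_on_subset by blast
  show "is_pole (\<lambda>z. rat_fun S (g z)) z \<and> rat_fun S (g z) = 0
      \<or> (\<lambda>z. rat_fun S (g z)) \<midarrow>z\<rightarrow> rat_fun S (g z)"
  proof (cases "poly (snd (quot_of_fract S)) (g z) = 0")
    case True
    then show ?thesis using is_pole_rat_comp_iff[OF assms] by (simp add: rat_fun_def)
  next
    case False
    then have "isCont (\<lambda>z. rat_fun S (g z)) z"
      unfolding rat_fun_def using gc by (intro continuous_intros) auto
    then show ?thesis by (simp add: isCont_def)
  qed
qed

lemma sphere_value_rat_fun:
  "sphere_value (rat_fun S) u =
     (if poly (snd (quot_of_fract S)) u = 0 then Infinity else Finite (rat_fun S u))"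
  using is_pole_rat_comp_iff[of "\<lambda>z. z"] by (simp add: sphere_value_def)

lemma rat_fun_nicely_meromorphic: "rat_fun S nicely_meromorphic_on UNIV"
  using rat_comp_nicely_meromorphic[of "\<lambda>z. z"] by simp

lemma rat_fun_exp_nicely_meromorphic:
  assumes "q > 0"
  shows "(\<lambda>z. rat_fun S (exp (z / of_nat q))) nicely_meromorphic_on UNIV"
proof (rule rat_comp_nicely_meromorphic)
  show "(\<lambda>z. exp (z / of_nat q)) analytic_on UNIV"
    using assms by (intro analytic_intros) auto
  fix z :: complex
  have "((\<lambda>z. exp (z / of_nat q)) has_field_derivative exp (z / of_nat q) / of_nat q) (at z)"
    using assms by (auto intro!: derivative_eq_intros)
  then show "deriv (\<lambda>z. exp (z / of_nat q)) z \<noteq> 0"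
    using assms by (simp add: DERIV_imp_deriv)
qed

end

theory Submission
  imports Defs
begin

text \<open>Write \<open>f\<close> as \<open>rat_fun S\<close> composed with g(z) = exp(z/q). This g
  is entire with nowhere vanishing derivative, maps onto the nonzero complex numbers, and satisfies
  exp z = g(z)^q. So the fibre of \<open>f\<close> over \<open>a\<close> is the g-preimage of the
  nonzero part of the fibre of S (\<open>sphere_value_rat_comp\<close>). Applying exp to it gives
  the q-th powers of those points, and there are finitely many because a nonconstant rational
  function has finite fibres (\<open>finite_rat_fun_fibre\<close>). The preimage of a single point
  under g is a coset of 2 pi i q Z (\<open>log_coset_eq\<close>). As g is locally biholomorphic,
  composing with it preserves multiplicities (\<open>local_mult_rat_comp\<close>).\<close>

lemma finite_rat_fun_level:
  assumes "nonconstant_rat S"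
  shows "finite {u. rat_fun S u = c}"
proof -
  define p r where "p = fst (quot_of_fract S)" and "r = snd (quot_of_fract S)"
  have r: "r \<noteq> 0" by (simp add: r_def)
  have "p - smult c r \<noteq> 0"
  proof
    assume "p - smult c r = 0"
    then have p: "p = r * [:c:]" by simp
    have "S = to_fract p / to_fract r"
      by (metis Fract_conv_to_fract Fract_quot_of_fract p_def r_def)
    also have "\<dots> = to_fract [:c:]"
      using r by (simp only: p to_fract_mult) simp
    finally show False using assms by (auto simp: nonconstant_rat_def)
  qed
  \<comment> \<open>The roots of \<open>r\<close> are included because division by zero gives
    \<open>rat_fun\<close> the value 0 there, which matters for \<open>c = 0\<close>.\<close>
  then have "finite ({u. poly (p - smult c r) u = 0} \<union> {u. poly r u = 0})"
    using r poly_roots_finite by blast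
  moreover have "{u. rat_fun S u = c} \<subseteq> {u. poly (p - smult c r) u = 0} \<union> {u. poly r u = 0}"
    by (auto simp: rat_fun_def p_def r_def field_simps)
  ultimately show ?thesis by (rule finite_subset[rotated])
qed

lemma finite_rat_fun_fibre:
  assumes "nonconstant_rat S"
  shows "finite {u. sphere_value (rat_fun S) u = a}"
proof (cases a)
  case (Finite c)
  \<comment> \<open>Only an inclusion: for \<open>c = 0\<close> the level set also contains the
    poles, by the default value.\<close>
  then have "{u. sphere_value (rat_fun S) u = a} \<subseteq> {u. rat_fun S u = c}"
    by (auto simp: sphere_value_def split: if_splits)
  then show ?thesis using finite_rat_fun_level[OF assms] finite_subset by blast
next
  case Infinity
  then have "{u. sphere_value (rat_fun S) u = a} = {u. poly (snd (quot_of_fract S)) u = 0}"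
    by (auto simp: sphere_value_rat_fun)
  then show ?thesis by (simp add: poly_roots_finite)
qed

text \<open>Orders multiply under composition, and \<open>g - g z\<close> has a simple zero at
  \<open>z\<close>.\<close>

lemma zorder_compose_deriv_nonzero:
  assumes h: "h meromorphic_on {g z}" and nz: "\<forall>\<^sub>F u in at (g z). h u \<noteq> 0"
    and g: "g analytic_on {z}" and g': "deriv g z \<noteq> 0"
  shows "zorder (\<lambda>w. h (g w)) z = zorder h (g z)"
proof -
  \<comment> \<open>The difference quotient tends to a nonzero limit, so \<open>g\<close> omits the
    value \<open>g z\<close> on a punctured neighbourhood of \<open>z\<close>.\<close>
  have gd: "(g has_field_derivative deriv g z) (at z)"
    using g analytic_on_imp_differentiable_at DERIV_deriv_iff_field_differentiable by blast
  then have "((\<lambda>w. (g w - g z) / (w - z)) \<longlongrightarrow> deriv g z) (at z)"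
    by (simp add: has_field_derivative_iff)
  then have "\<forall>\<^sub>F w in at z. (g w - g z) / (w - z) \<noteq> 0"
    by (rule tendsto_imp_eventually_ne) (rule g')
  then have ne: "\<forall>\<^sub>F w in at z. g w \<noteq> g z"
    by (rule eventually_mono) auto
  have "deriv (\<lambda>w. g w - g z) z = deriv g z"
    using gd by (intro DERIV_imp_deriv derivative_eq_intros) auto
  moreover have "(\<lambda>w. g w - g z) analytic_on {z}"
    by (intro analytic_intros g)
  ultimately have "zorder (\<lambda>w. g w - g z) z = 1"
    using zorder_zero_eqI'[of "\<lambda>w. g w - g z" z 1] g' by simp
  then show ?thesis
    using zorder_compose'[OF _ _ g nz ne] h
    by (simp add: meromorphic_on_altdef o_def)
qed

lemma sphere_value_rat_comp:
  assumes "g analytic_on UNIV" "\<And>z. deriv g z \<noteq> 0"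
  shows "sphere_value (\<lambda>w. rat_fun S (g w)) z = sphere_value (rat_fun S) (g z)"
  by (simp add: sphere_value_def[of "\<lambda>w. rat_fun S (g w)"] sphere_value_rat_fun
      is_pole_rat_comp_iff[OF assms])

lemma local_mult_rat_comp:
  assumes S: "nonconstant_rat S" and g: "g analytic_on UNIV" "\<And>z. deriv g z \<noteq> 0"
  shows "local_mult (\<lambda>w. rat_fun S (g w)) z = local_mult (rat_fun S) (g z)"
proof -
  have pole: "is_pole (\<lambda>w. rat_fun S (g w)) z \<longleftrightarrow> is_pole (rat_fun S) (g z)"
    using is_pole_rat_comp_iff[OF g] is_pole_rat_comp_iff[of "\<lambda>z. z"] by simp
  have mero: "rat_fun S meromorphic_on {g z}"
    using rat_fun_nicely_meromorphic[of S] meromorphic_on_subset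
    unfolding nicely_meromorphic_on_def by blast
  have gz: "g analytic_on {z}" using g(1) analytic_on_subset by blast
  \<comment> \<open>The constant is left free: \<open>c = 0\<close> serves the pole case of
    \<open>local_mult\<close>, and \<open>c = rat_fun S (g z)\<close> the other case.\<close>
  have zord: "zorder (\<lambda>w. rat_fun S (g w) - c) z = zorder (\<lambda>u. rat_fun S u - c) (g z)" for c
  proof (rule zorder_compose_deriv_nonzero[where h = "\<lambda>u. rat_fun S u - c"])
    show "(\<lambda>u. rat_fun S u - c) meromorphic_on {g z}"
      by (intro meromorphic_intros mero)
    \<comment> \<open>A finite level set stays away from a small punctured disc around
      \<open>g z\<close>, even if it contains \<open>g z\<close> itself.\<close>
    have "\<forall>\<^sub>F u in at (g z). \<forall>v\<in>{u. rat_fun S u = c}. u \<noteq> v"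
      using finite_rat_fun_level[OF S]
      by (intro eventually_ball_finite) (auto simp: eventually_neq_at_within)
    then show "\<forall>\<^sub>F u in at (g z). rat_fun S u - c \<noteq> 0"
      by (rule eventually_mono) auto
  qed (use gz g(2) in auto)
  show ?thesis
    using zord[of 0] zord[of "rat_fun S (g z)"] by (simp add: local_mult_def pole)
qed

text \<open>The period 2 pi i of exp becomes 2 pi i q after scaling by \<open>q\<close>. Since only
  \<open>exp l\<close> enters on the right, the coset does not depend on which logarithm is
  chosen.\<close>

lemma log_coset_eq:
  assumes "q > 0"
  shows "log_coset q l = {z. exp (z / of_nat q) = exp l}"
proof -
  have "z / of_nat q = l + of_int (2 * k) * of_real pi * \<i> \<longleftrightarrow>
      z = of_nat q * l + 2 * of_real pi * \<i> * of_nat q * of_int k" for z and k :: int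
    using assms by (simp add: divide_eq_eq algebra_simps)
  then show ?thesis by (auto simp: log_coset_def exp_eq)
qed

theorem proposition7p4:
  fixes S :: "complex poly fract" and q :: nat and f :: "complex \<Rightarrow> complex"
  assumes "q > 0"
    and "nonconstant_rat S"
    and "f = (\<lambda>z. rat_fun S (exp (z / of_nat q)))"
  shows "\<forall>a. finite (exp_fibre f a)
    \<and> exp_fibre f a = {\<alpha> ^ q | \<alpha>. \<alpha> \<noteq> 0 \<and> sphere_value (rat_fun S) \<alpha> = a}
    \<and> (\<forall>L. (\<forall>\<alpha>. \<alpha> \<noteq> 0 \<and> sphere_value (rat_fun S) \<alpha> = a \<longrightarrow> exp (L \<alpha>) = \<alpha>) \<longrightarrow>
          fibre f a = (\<Union>\<alpha>\<in>{\<alpha>. \<alpha> \<noteq> 0 \<and> sphere_value (rat_fun S) \<alpha> = a}. log_coset q (L \<alpha>)))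
    \<and> (\<forall>\<alpha> l z. \<alpha> \<noteq> 0 \<and> sphere_value (rat_fun S) \<alpha> = a \<and> exp l = \<alpha> \<and> z \<in> log_coset q l \<longrightarrow>
          local_mult f z = local_mult (rat_fun S) \<alpha>)"
proof -
  note q = \<open>q > 0\<close> and S = \<open>nonconstant_rat S\<close>
  define g where "g = (\<lambda>z :: complex. exp (z / of_nat q))"
  have g: "g analytic_on UNIV"
    unfolding g_def using q by (intro analytic_intros) auto
  have "deriv g z = g z / of_nat q" for z
    unfolding g_def using q by (intro DERIV_imp_deriv) (auto intro!: derivative_eq_intros)
  then have g': "deriv g z \<noteq> 0" for z
    using q by (simp add: g_def)
  have f: "f = (\<lambda>z. rat_fun S (g z))"
    using assms(3) by (simp add: g_def)
  have g_nz: "g z \<noteq> 0" for z by (simp add: g_def)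
  have exp_g: "exp z = g z ^ q" for z
    using q by (simp add: g_def flip: exp_of_nat_mult)
  have g_surj: "\<exists>z. g z = \<alpha>" if "\<alpha> \<noteq> 0" for \<alpha>
    using that q by (intro exI[of _ "of_nat q * Ln \<alpha>"]) (simp add: g_def)
  have coset: "z \<in> log_coset q l \<longleftrightarrow> g z = exp l" for z l
    by (simp add: log_coset_eq[OF q] g_def)
  have fib: "z \<in> fibre f a \<longleftrightarrow> sphere_value (rat_fun S) (g z) = a" for z a
    by (simp add: fibre_def f sphere_value_rat_comp[OF g g'])
  have E: "exp_fibre f a = {\<alpha> ^ q | \<alpha>. \<alpha> \<noteq> 0 \<and> sphere_value (rat_fun S) \<alpha> = a}" (is "_ = ?E") for a
  proof
    show "exp_fibre f a \<subseteq> ?E"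
      using g_nz by (auto simp: exp_fibre_def fib exp_g)
    show "?E \<subseteq> exp_fibre f a"
    proof
      fix w assume "w \<in> ?E"
      then obtain \<alpha> where \<alpha>: "w = \<alpha> ^ q" "\<alpha> \<noteq> 0" "sphere_value (rat_fun S) \<alpha> = a" by blast
      then obtain z where "g z = \<alpha>" using g_surj by blast
      with \<alpha> have "w = exp z" "z \<in> fibre f a" by (simp_all add: exp_g fib)
      then show "w \<in> exp_fibre f a" by (simp add: exp_fibre_def)
    qed
  qed
  have fin: "finite (exp_fibre f a)" for a
  proof (rule finite_subset)
    \<comment> \<open>The bounding set may also contain the power of \<open>\<alpha> = 0\<close>,
      which does no harm to finiteness.\<close>
    show "exp_fibre f a \<subseteq> (\<lambda>\<alpha>. \<alpha> ^ q) ` {\<alpha>. sphere_value (rat_fun S) \<alpha> = a}"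
      by (auto simp: E)
    show "finite ((\<lambda>\<alpha>. \<alpha> ^ q) ` {\<alpha>. sphere_value (rat_fun S) \<alpha> = a})"
      using finite_rat_fun_fibre[OF S] by simp
  qed
  have cosets: "fibre f a
      = (\<Union>\<alpha>\<in>{\<alpha>. \<alpha> \<noteq> 0 \<and> sphere_value (rat_fun S) \<alpha> = a}. log_coset q (L \<alpha>))"
    if "\<forall>\<alpha>. \<alpha> \<noteq> 0 \<and> sphere_value (rat_fun S) \<alpha> = a \<longrightarrow> exp (L \<alpha>) = \<alpha>" for a L
    using that g_nz by (auto simp: fib coset)
  \<comment> \<open>The multiplicity depends on \<open>z\<close> only through \<open>g z\<close>,
    which is constant on each coset.\<close>
  have "local_mult f z = local_mult (rat_fun S) (g z)" for z
    unfolding f by (rule local_mult_rat_comp[OF S g g'])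
  then have mult: "local_mult f z = local_mult (rat_fun S) \<alpha>"
    if "exp l = \<alpha>" "z \<in> log_coset q l" for \<alpha> l z
    using that by (simp add: coset)
  show ?thesis
    using E fin cosets mult by blast
qed

end
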